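(* Let $(\mathcal{S}^0,J)$ be an Inoue surface of type $\mathcal{S}^0$, i.e. $\mathcal{S}^0=(\mathbb{C}\times\mathbb{H})/G_A$ with the complex structure $J$ inherited from $\mathbb{C}\times\mathbb{H}$, and let $\theta_1=t\vartheta$ with $t\in\mathbb{R}$. If $\omega_1$ is an LCK form on $(\mathcal{S}^0,J)$ with Lee form $\theta_1$, then $\omega_1$ is not $d_{\theta_1}$-exact, i.e. there is no one-form $\eta$ on $\mathcal{S}^0$ with $\omega_1=d\eta-\theta_1\wedge\eta$.
   Context: LCK forms: a Hermitian metric $g$ on a complex manifold $(M,J)$, with fundamental two-form $\omega(X,Y)=g(JX,Y)$, is called locally conformally Kähler (LCK) if there is a closed one-form $\theta_1$ (its Lee form) with $d\omega=\theta_1\wedge\omega$; $\omega$ is then called an LCK form. For a closed one-form $\eta$, $d_\eta=d-\eta\wedge\cdot$. Inoue surface $\mathcal{S}^0$: let $A\in \mathrm{SL}_3(\mathbb{Z})$ have one real eigenvalue $\alpha>1$ and two complex (non-real) eigenvalues $\beta,\bar\beta$. Let $(a_1,a_2,a_3)^t$ be a real eigenvector for $\alpha$ and $(b_1,b_2,b_3)^t$ a complex eigenvector for $\beta$. Let $\mathbb{H}$ be the upper half-plane and $G_A$ the group of transformations of $\mathbb{C}\times\mathbb{H}$ (coordinates $(z,w)$, $w_2=\operatorname{Im}w$) generated by $(z,w)\mapsto(\beta z,\alpha w)$ and $(z,w)\mapsto(z+b_i,w+a_i)$, $i=1,2,3$. Then $\mathcal{S}^0=(\mathbb{C}\times\mathbb{H})/G_A$,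 a compact complex surface. The closed one-form $\vartheta$ is the one induced on $\mathcal{S}^0$ by $\frac{1}{\ln\alpha}\frac{dw_2}{w_2}$ (the pullback of the volume form of the circle of length 1 under $[(z,w)]\mapsto e^{2\pi\mathrm{i}\log_\alpha w_2}$). Since $b_1(\mathcal{S}^0)=1$, every closed one-form on $\mathcal{S}^0$ is, up to adding an exact one-form, a real multiple of $\vartheta$. *)

theory Defs
  imports "HOL-Analysis.Analysis" "HOL-Algebra.Bij" "HOL-Algebra.Generated_Groups"
begin

section \<open>Tensors on a complex surface given by an atlas\<close>

text \<open>
  A complex surface is given by a holomorphic atlas: a set of charts (U, phi), where U is a
  subset of the surface and phi maps U bijectively onto an open subset of C x C (the values of
  phi outside U are irrelevant). A tensor field assigns to every chart its coordinate
  expression on phi ` U, and the expressions of any two charts are related by pullback along the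
  coordinate change. Tangent vectors are written in the real coordinates of C x C.
  All tensor fields are smooth.
\<close>

type_synonym cvec = "complex \<times> complex"
type_synonym 'a chart = "'a set \<times> ('a \<Rightarrow> cvec)"
type_synonym 'a tensor1 = "'a chart \<Rightarrow> cvec \<Rightarrow> cvec \<Rightarrow> real"
type_synonym 'a tensor2 = "'a chart \<Rightarrow> cvec \<Rightarrow> cvec \<Rightarrow> cvec \<Rightarrow> real"
type_synonym 'a tensor3 = "'a chart \<Rightarrow> cvec \<Rightarrow> cvec \<Rightarrow> cvec \<Rightarrow> cvec \<Rightarrow> real"

primrec Ck_on :: "nat \<Rightarrow> 'a::real_normed_vector set \<Rightarrow> ('a \<Rightarrow> 'b::real_normed_vector) \<Rightarrow> bool" where
  "Ck_on 0 S f \<longleftrightarrow> continuous_on S f"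
| "Ck_on (Suc k) S f \<longleftrightarrow> (\<forall>x\<in>S. f differentiable (at x)) \<and>
     (\<forall>v. Ck_on k S (\<lambda>x. frechet_derivative f (at x) v))"

definition smooth_on :: "'a::real_normed_vector set \<Rightarrow> ('a \<Rightarrow> 'b::real_normed_vector) \<Rightarrow> bool" where
  "smooth_on S f \<longleftrightarrow> (\<forall>k. Ck_on k S f)"

definition chart_image :: "'a chart \<Rightarrow> cvec set" where
  "chart_image c = snd c ` fst c"

definition transition :: "'a chart \<Rightarrow> 'a chart \<Rightarrow> cvec \<Rightarrow> cvec" where
  "transition c c' = snd c' \<circ> inv_into (fst c) (snd c)"

definition Dtransition :: "'a chart \<Rightarrow> 'a chart \<Rightarrow> 'a \<Rightarrow> cvec \<Rightarrow> cvec" where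
  "Dtransition c c' p = frechet_derivative (transition c c') (at (snd c p))"

definition one_form :: "'a chart set \<Rightarrow> 'a tensor1 \<Rightarrow> bool" where
  "one_form \<A> \<eta> \<longleftrightarrow>
     (\<forall>c\<in>\<A>. (\<forall>x\<in>chart_image c. linear (\<eta> c x)) \<and>
             (\<forall>v. smooth_on (chart_image c) (\<lambda>x. \<eta> c x v))) \<and>
     (\<forall>c\<in>\<A>. \<forall>c'\<in>\<A>. \<forall>p\<in>fst c \<inter> fst c'. \<forall>v.
        \<eta> c (snd c p) v = \<eta> c' (snd c' p) (Dtransition c c' p v))"

definition two_tensor :: "'a chart set \<Rightarrow> 'a tensor2 \<Rightarrow> bool" where
  "two_tensor \<A> \<omega> \<longleftrightarrow>
     (\<forall>c\<in>\<A>. (\<forall>x\<in>chart_image c. bilinear (\<omega> c x)) \<and>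
             (\<forall>u v. smooth_on (chart_image c) (\<lambda>x. \<omega> c x u v))) \<and>
     (\<forall>c\<in>\<A>. \<forall>c'\<in>\<A>. \<forall>p\<in>fst c \<inter> fst c'. \<forall>u v.
        \<omega> c (snd c p) u v = \<omega> c' (snd c' p) (Dtransition c c' p u) (Dtransition c c' p v))"

definition two_form :: "'a chart set \<Rightarrow> 'a tensor2 \<Rightarrow> bool" where
  "two_form \<A> \<omega> \<longleftrightarrow> two_tensor \<A> \<omega> \<and>
     (\<forall>c\<in>\<A>. \<forall>x\<in>chart_image c. \<forall>u v. \<omega> c x u v = - \<omega> c x v u)"

text \<open>
  Exterior derivatives are computed in a chart, on constant vector fields (whose Lie brackets
  vanish).
\<close>

definition ext_d1 :: "'a tensor1 \<Rightarrow> 'a tensor2" where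
  "ext_d1 \<eta> c x u v =
     frechet_derivative (\<lambda>y. \<eta> c y v) (at x) u - frechet_derivative (\<lambda>y. \<eta> c y u) (at x) v"

definition ext_d2 :: "'a tensor2 \<Rightarrow> 'a tensor3" where
  "ext_d2 \<omega> c x u v w =
     frechet_derivative (\<lambda>y. \<omega> c y v w) (at x) u
     - frechet_derivative (\<lambda>y. \<omega> c y u w) (at x) v
     + frechet_derivative (\<lambda>y. \<omega> c y u v) (at x) w"

definition wedge11 :: "'a tensor1 \<Rightarrow> 'a tensor1 \<Rightarrow> 'a tensor2" where
  "wedge11 \<theta> \<eta> c x u v = \<theta> c x u * \<eta> c x v - \<theta> c x v * \<eta> c x u"

definition wedge12 :: "'a tensor1 \<Rightarrow> 'a tensor2 \<Rightarrow> 'a tensor3" where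
  "wedge12 \<theta> \<omega> c x u v w =
     \<theta> c x u * \<omega> c x v w - \<theta> c x v * \<omega> c x u w + \<theta> c x w * \<omega> c x u v"

definition closed_one_form :: "'a chart set \<Rightarrow> 'a tensor1 \<Rightarrow> bool" where
  "closed_one_form \<A> \<theta> \<longleftrightarrow> one_form \<A> \<theta> \<and>
     (\<forall>c\<in>\<A>. \<forall>x\<in>chart_image c. \<forall>u v. ext_d1 \<theta> c x u v = 0)"

text \<open>In holomorphic coordinates the complex structure is multiplication by i.\<close>

definition cplx_J :: "cvec \<Rightarrow> cvec" where
  "cplx_J v = (\<i> * fst v, \<i> * snd v)"

definition hermitian_metric :: "'a chart set \<Rightarrow> 'a tensor2 \<Rightarrow> bool" where
  "hermitian_metric \<A> g \<longleftrightarrow> two_tensor \<A> g \<and>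
     (\<forall>c\<in>\<A>. \<forall>x\<in>chart_image c.
        (\<forall>u v. g c x u v = g c x v u) \<and>
        (\<forall>u. u \<noteq> 0 \<longrightarrow> g c x u u > 0) \<and>
        (\<forall>u v. g c x (cplx_J u) (cplx_J v) = g c x u v))"

definition fundamental_form :: "'a chart set \<Rightarrow> 'a tensor2 \<Rightarrow> 'a tensor2 \<Rightarrow> bool" where
  "fundamental_form \<A> g \<omega> \<longleftrightarrow> two_form \<A> \<omega> \<and>
     (\<forall>c\<in>\<A>. \<forall>x\<in>chart_image c. \<forall>u v. \<omega> c x u v = g c x (cplx_J u) v)"

definition LCK_form :: "'a chart set \<Rightarrow> 'a tensor2 \<Rightarrow> 'a tensor1 \<Rightarrow> bool" where
  "LCK_form \<A> \<omega> \<theta> \<longleftrightarrow>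
     (\<exists>g. hermitian_metric \<A> g \<and> fundamental_form \<A> g \<omega>) \<and>
     closed_one_form \<A> \<theta> \<and>
     (\<forall>c\<in>\<A>. \<forall>x\<in>chart_image c. \<forall>u v w. ext_d2 \<omega> c x u v w = wedge12 \<theta> \<omega> c x u v w)"

definition twisted_exact :: "'a chart set \<Rightarrow> 'a tensor1 \<Rightarrow> 'a tensor2 \<Rightarrow> bool" where
  "twisted_exact \<A> \<theta> \<omega> \<longleftrightarrow>
     (\<exists>\<eta>. one_form \<A> \<eta> \<and>
        (\<forall>c\<in>\<A>. \<forall>x\<in>chart_image c. \<forall>u v.
           \<omega> c x u v = ext_d1 \<eta> c x u v - wedge11 \<theta> \<eta> c x u v))"

section \<open>Inoue surfaces\<close>

text \<open>
  The eigenvalues alpha, beta and the conjugate of beta are pairwise distinct, so they are all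
  the eigenvalues of the matrix.
\<close>

definition inoue_data :: "int^3^3 \<Rightarrow> real \<Rightarrow> complex \<Rightarrow> real^3 \<Rightarrow> complex^3 \<Rightarrow> bool" where
  "inoue_data A \<alpha> \<beta> a b \<longleftrightarrow>
     det A = 1 \<and> \<alpha> > 1 \<and> \<beta> \<notin> \<real> \<and>
     a \<noteq> 0 \<and> map_matrix real_of_int A *v a = \<alpha> *s a \<and>
     b \<noteq> 0 \<and> map_matrix complex_of_int A *v b = \<beta> *s b"

definition CH :: "(complex \<times> complex) set" where
  "CH = UNIV \<times> {w. Im w > 0}"

definition inoue_dilation :: "real \<Rightarrow> complex \<Rightarrow> complex \<times> complex \<Rightarrow> complex \<times> complex" where
  "inoue_dilation \<alpha> \<beta> = (\<lambda>(z, w)\<in>CH. (\<beta> * z, of_real \<alpha> * w))"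

definition inoue_translation ::
    "real^3 \<Rightarrow> complex^3 \<Rightarrow> 3 \<Rightarrow> complex \<times> complex \<Rightarrow> complex \<times> complex" where
  "inoue_translation a b i = (\<lambda>(z, w)\<in>CH. (z + b $ i, w + of_real (a $ i)))"

definition inoue_group ::
    "real \<Rightarrow> complex \<Rightarrow> real^3 \<Rightarrow> complex^3 \<Rightarrow> (complex \<times> complex \<Rightarrow> complex \<times> complex) set" where
  "inoue_group \<alpha> \<beta> a b =
     generate (BijGroup CH) (insert (inoue_dilation \<alpha> \<beta>) (range (inoue_translation a b)))"

text \<open>The points of the surface are the orbits.\<close>

definition inoue_proj ::
    "real \<Rightarrow> complex \<Rightarrow> real^3 \<Rightarrow> complex^3 \<Rightarrow> complex \<times> complex \<Rightarrow> (complex \<times> complex) set" where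
  "inoue_proj \<alpha> \<beta> a b x = (\<lambda>g. g x) ` inoue_group \<alpha> \<beta> a b"

text \<open>
  The complex structure inherited from the covering: the charts are the inverses of the
  restrictions of the projection to the open subsets on which it is injective.
\<close>

definition inoue_atlas ::
    "real \<Rightarrow> complex \<Rightarrow> real^3 \<Rightarrow> complex^3 \<Rightarrow> (complex \<times> complex) set chart set" where
  "inoue_atlas \<alpha> \<beta> a b =
     {(inoue_proj \<alpha> \<beta> a b ` V, inv_into V (inoue_proj \<alpha> \<beta> a b)) | V.
        open V \<and> V \<subseteq> CH \<and> inj_on (inoue_proj \<alpha> \<beta> a b) V}"

text \<open>
  As the charts above are local inverses of the projection, the form induced by a form on the
  covering has the same coordinate expression in each of them; here it is
  d(Im w) / (ln alpha * Im w).
\<close>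

definition inoue_vartheta :: "real \<Rightarrow> (complex \<times> complex) set tensor1" where
  "inoue_vartheta \<alpha> c x v = Im (snd v) / (ln \<alpha> * Im (snd x))"

end

theory Submission
  imports Defs
begin

text \<open>
  The obstruction to exactness lives in the direction of the complex coordinate z. Lift the forms
  to C x H, so that \<omega> = d \<eta> - \<theta> \<and> \<eta>, and evaluate on the constant fields
  e = (1, 0) and J e = (i, 0). The form \<theta> is a multiple of d(Im w) / Im w, so it kills both
  fields, and with z = x + i y

    \<omega>(e, J e) = d(\<eta>(J e))/dx - d(\<eta>(e))/dy.

  The left-hand side is positive, being the squared length of J e. All three functions are
  invariant under the translations by (b_i, a_i), and these span a lattice of full rank in
  C x R (lemma \<open>lattice_cocompact\<close>). Hence on the slice Im w = 1 the left-hand side is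
  bounded below by some \<epsilon> > 0, while \<eta>(e) and \<eta>(J e) are bounded
  (lemma \<open>periodic_slice_bounds\<close>). On the plane w = i this contradicts Stokes' theorem:
  the integral of the left-hand side over a square of side L is at least \<epsilon> L^2, and the
  boundary integral is at most a constant times L
  (lemma \<open>divergence_of_bounded_field_not_uniformly_positive\<close>).

  The full rank holds because a, b and the conjugate of b are eigenvectors for distinct
  eigenvalues (lemma \<open>eigenvector_relation_trivial\<close>). To lift tensor fields, every point
  of C x H must lie in an open set on which the projection is injective
  (lemma \<open>section_domain_exists\<close>). This holds since a deck transformation either multiplies
  Im w by a power of \<alpha> other than 1 or is a translation by an element of the discrete
  lattice. For the latter the lattice has to be stable under the inverse of the dilation too,
  which is where det A = 1 enters.
\<close>

section \<open>An obstruction in the plane\<close>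

text \<open>
  The divergence theorem on a growing domain, arranged as a one-dimensional argument: the integral
  P(x) of p(x, y) over y in [0, L] has a derivative of at least \<epsilon> L - 2 C, because the
  contribution of q is the difference of two boundary values. If L is large, P grows at least
  linearly, but it is bounded by C L.
\<close>

lemma divergence_of_bounded_field_not_uniformly_positive:
  fixes p p' q q' :: "real \<Rightarrow> real \<Rightarrow> real"
  assumes p: "\<And>x y. ((\<lambda>x. p x y) has_real_derivative p' x y) (at x)"
    and q: "\<And>x y. ((\<lambda>y. q x y) has_real_derivative q' x y) (at y)"
    and contp: "\<And>x. continuous_on UNIV (p x)"
    and contp': "continuous_on UNIV (\<lambda>(x, y). p' x y)"
    and boundp: "\<And>x y. \<bar>p x y\<bar> \<le> C" and boundq: "\<And>x y. \<bar>q x y\<bar> \<le> C"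
    and "\<epsilon> > 0" and lower: "\<And>x y. \<epsilon> \<le> p' x y - q' x y"
  shows False
proof -
  have "C \<ge> 0" using boundp[of 0 0] by linarith
  \<comment> \<open>the side for which the lower bound \<open>\<epsilon> * L - 2 * C\<close> of the derivative is 1\<close>
  define L where "L = (2 * C + 1) / \<epsilon>"
  have "L > 0" and L: "\<epsilon> * L = 2 * C + 1"
    using \<open>C \<ge> 0\<close> \<open>\<epsilon> > 0\<close> by (auto simp: L_def)
  define P where "P x = integral {0..L} (p x)" for x
  define P' where "P' x = integral {0..L} (p' x)" for x
  have int_p: "p x integrable_on {0..L}" for x
    by (intro integrable_continuous_real continuous_on_subset[OF contp]) auto
  have int_p': "p' x integrable_on {0..L}" for x
    by (intro integrable_continuous_real
        continuous_on_compose2[OF contp', of _ "\<lambda>y. (x, y)", simplified] continuous_intros)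
  have P_deriv: "(P has_real_derivative P' x) (at x)" for x
    unfolding P_def P'_def
    using leibniz_rule_field_derivative[of UNIV 0 L p p' x] p int_p contp'
    by (auto intro: continuous_on_subset)
  have P'_ge: "P' x \<ge> 1" for x
  proof -
    have "((\<lambda>y. q' x y) has_integral q x L - q x 0) {0..L}"
      using q \<open>L > 0\<close> by (intro fundamental_theorem_of_calculus)
        (auto simp: has_real_derivative_iff_has_vector_derivative[symmetric]
          intro: has_field_derivative_at_within)
    then have "((\<lambda>y. \<epsilon> + q' x y) has_integral \<epsilon> * L + (q x L - q x 0)) {0..L}"
      using \<open>L > 0\<close> has_integral_add[OF has_integral_const_real[of \<epsilon> 0 L]] by (simp add: mult.commute)
    then have "\<epsilon> * L + (q x L - q x 0) \<le> P' x"
      unfolding P'_def using lower[of x]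
      by (intro has_integral_le[OF _ integrable_integral[OF int_p']]) (auto simp: algebra_simps)
    then show ?thesis using L boundq[of x L] boundq[of x 0] by linarith
  qed
  have P_bound: "\<bar>P x\<bar> \<le> C * L" for x
    unfolding P_def using integral_bound[of 0 L "p x" C] \<open>L > 0\<close> boundp contp
    by (auto intro: continuous_on_subset)
  define X where "X = 2 * (C * L) + 1"
  have "X > 0" using \<open>C \<ge> 0\<close> \<open>L > 0\<close> by (auto simp: X_def intro: add_nonneg_pos)
  obtain \<xi> where "P X - P 0 = (X - 0) * P' \<xi>"
    using MVT2[OF \<open>X > 0\<close>, of P P'] P_deriv by blast
  moreover have "X * P' \<xi> \<ge> X" using P'_ge[of \<xi>] \<open>X > 0\<close> by simp
  ultimately show False using P_bound[of X] P_bound[of 0] by (simp add: X_def abs_le_iff)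
qed

section \<open>The lattice of periods\<close>

text \<open>
  The inverse is the adjugate matrix; its entries lie in the ring itself, so the inverse of a
  unimodular integer matrix is an integer matrix.
\<close>

lemma unimodular_3_left_inverse:
  fixes A :: "'a::comm_ring_1^3^3"
  assumes "det A = 1"
  obtains B where "B ** A = mat 1"
proof
  let ?B = "vector
    [vector [A$2$2 * A$3$3 - A$2$3 * A$3$2, A$1$3 * A$3$2 - A$1$2 * A$3$3, A$1$2 * A$2$3 - A$1$3 * A$2$2],
     vector [A$2$3 * A$3$1 - A$2$1 * A$3$3, A$1$1 * A$3$3 - A$1$3 * A$3$1, A$1$3 * A$2$1 - A$1$1 * A$2$3],
     vector [A$2$1 * A$3$2 - A$2$2 * A$3$1, A$1$2 * A$3$1 - A$1$1 * A$3$2, A$1$1 * A$2$2 - A$1$2 * A$2$1]]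
    :: 'a^3^3"
  show "?B ** A = mat 1"
    using assms
    by (simp add: det_3 vec_eq_iff forall_3 matrix_matrix_mult_def sum_3 mat_def algebra_simps)
qed

lemma one_form_smooth:
  "one_form \<A> \<eta> \<Longrightarrow> c \<in> \<A> \<Longrightarrow> smooth_on (chart_image c) (\<lambda>x. \<eta> c x v)"
  unfolding one_form_def by (drule conjunct1) (drule (1) bspec, drule conjunct2, erule spec)

lemma two_tensor_smooth:
  "two_tensor \<A> \<omega> \<Longrightarrow> c \<in> \<A> \<Longrightarrow> smooth_on (chart_image c) (\<lambda>x. \<omega> c x u v)"
  unfolding two_tensor_def by (drule conjunct1) (drule (1) bspec, drule conjunct2, drule spec, erule spec)

locale inoue_surface =
  fixes A :: "int^3^3" and \<alpha> :: real and \<beta> :: complex and a :: "real^3" and b :: "complex^3"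
  assumes data: "inoue_data A \<alpha> \<beta> a b"
begin

lemma alpha_gt_1: "\<alpha> > 1" and beta_nonreal: "Im \<beta> \<noteq> 0"
  using data by (auto simp: inoue_data_def complex_is_Real_iff)

lemma beta_nonzero: "\<beta> \<noteq> 0"
  using beta_nonreal by auto

lemma eigen_a: "(\<Sum>j\<in>UNIV. of_int (A$i$j) * a$j) = \<alpha> * a$i"
  and eigen_b: "(\<Sum>j\<in>UNIV. of_int (A$i$j) * b$j) = \<beta> * b$i"
proof -
  have "(map_matrix real_of_int A *v a) $ i = (\<alpha> *s a) $ i"
    "(map_matrix complex_of_int A *v b) $ i = (\<beta> *s b) $ i"
    using data by (auto simp: inoue_data_def)
  then show "(\<Sum>j\<in>UNIV. of_int (A$i$j) * a$j) = \<alpha> * a$i"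
    "(\<Sum>j\<in>UNIV. of_int (A$i$j) * b$j) = \<beta> * b$i"
    by (auto simp: matrix_vector_mult_def map_matrix_def)
qed

definition period :: "real^3 \<Rightarrow> complex \<times> complex" where
  "period c = (\<Sum>i\<in>UNIV. of_real (c$i) * b$i, of_real (\<Sum>i\<in>UNIV. c$i * a$i))"

definition period_lattice :: "(complex \<times> complex) set" where
  "period_lattice = period ` {m. \<forall>i. m$i \<in> \<int>}"

lemma linear_period: "linear period"
  by (rule linearI)
     (auto simp: period_def algebra_simps sum.distrib sum_distrib_left scaleR_conv_of_real[where 'a=complex])

lemma lattice_zero: "0 \<in> period_lattice"
  unfolding period_lattice_def using linear_0[OF linear_period] by (force intro: image_eqI[of _ _ 0])

lemma lattice_add: "\<kappa> \<in> period_lattice \<Longrightarrow> \<mu> \<in> period_lattice \<Longrightarrow> \<kappa> + \<mu> \<in> period_lattice"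
  unfolding period_lattice_def using linear_add[OF linear_period, symmetric] by (fastforce intro!: imageI)

lemma lattice_minus: "\<kappa> \<in> period_lattice \<Longrightarrow> - \<kappa> \<in> period_lattice"
  unfolding period_lattice_def using linear_neg[OF linear_period, symmetric] by (fastforce intro!: imageI)

lemma lattice_Im: "\<kappa> \<in> period_lattice \<Longrightarrow> Im (snd \<kappa>) = 0"
  by (auto simp: period_lattice_def period_def)

lemma lattice_CH: "\<kappa> \<in> period_lattice \<Longrightarrow> x + \<kappa> \<in> CH \<longleftrightarrow> x \<in> CH"
  using lattice_Im[of \<kappa>] by (cases x; cases \<kappa>) (auto simp: CH_def)

text \<open>
  Applying A to a linear relation between Re (\<mu> b) and a multiplies the coefficients by the
  eigenvalues.
\<close>

lemma eigenvector_relation_step: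
  assumes "\<And>i. Re (\<mu> * b$i) + x * a$i = 0"
  shows "Re (\<mu> * \<beta> * b$i) + x * \<alpha> * a$i = 0"
proof -
  have "Re (\<mu> * \<beta> * b$i) + x * \<alpha> * a$i
      = Re (\<mu> * (\<Sum>j\<in>UNIV. of_int (A$i$j) * b$j)) + x * (\<Sum>j\<in>UNIV. of_int (A$i$j) * a$j)"
    by (simp only: eigen_a eigen_b mult.assoc)
  also have "\<dots> = (\<Sum>j\<in>UNIV. of_int (A$i$j) * (Re (\<mu> * b$j) + x * a$j))"
  proof -
    have "Re (\<mu> * (of_int k * z)) = of_int k * Re (\<mu> * z)" for k z
      by (simp add: algebra_simps)
    then show ?thesis
      by (simp add: sum_distrib_left Re_sum sum.distrib distrib_left mult.left_commute
          del: times_complex.simps)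
  qed
  also have "\<dots> = 0" using assms by simp
  finally show ?thesis .
qed

text \<open>
  The real relations between Re b, Im b and a are those of the form below. Subtracting \<alpha>
  times the relation from its image under A eliminates a, leaving Re (\<nu> b) = 0 with \<nu> = \<mu> (\<beta> - \<alpha>); one further application of A
  makes both \<nu> b and \<beta> \<nu> b purely imaginary; as \<beta> is not real, \<nu> b = 0.
\<close>

lemma eigenvector_relation_trivial:
  assumes "\<And>i. Re (\<mu> * b$i) + x * a$i = 0"
  shows "\<mu> = 0 \<and> x = 0"
proof -
  define \<nu> where "\<nu> = \<mu> * (\<beta> - of_real \<alpha>)"
  have \<nu>: "Re (\<nu> * b$i) + 0 * a$i = 0" for i
  proof -
    have "Re (\<nu> * b$i) = Re (\<mu> * \<beta> * b$i) - \<alpha> * Re (\<mu> * b$i)"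
      by (simp add: \<nu>_def algebra_simps)
    also have "\<dots> = 0"
      using eigenvector_relation_step[OF assms, of i] assms[of i] by algebra
    finally show ?thesis by simp
  qed
  have "\<nu> * b$i = 0" for i
  proof -
    have "Re (\<nu> * b$i) = 0" "Re (\<nu> * b$i * \<beta>) = 0"
      using \<nu>[of i] eigenvector_relation_step[OF \<nu>, of i] by (simp_all add: mult.commute mult.left_commute)
    then show ?thesis
      using beta_nonreal by (auto simp: complex_eq_iff)
  qed
  moreover obtain i where "b$i \<noteq> 0"
    using data by (auto simp: inoue_data_def vec_eq_iff)
  ultimately have "\<nu> = 0" by (metis mult_eq_0_iff)
  moreover have "\<beta> \<noteq> of_real \<alpha>" using beta_nonreal by auto
  ultimately have "\<mu> = 0" by (simp add: \<nu>_def)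
  moreover obtain j where "a$j \<noteq> 0"
    using data by (auto simp: inoue_data_def vec_eq_iff)
  ultimately show ?thesis using assms[of j] by simp
qed

lemma period_bij:
  obtains M N :: "real^3^3" where "M ** N = mat 1" "N ** M = mat 1"
    "\<And>c. period c = (Complex ((c v* M)$1) ((c v* M)$2), of_real ((c v* M)$3))"
proof -
  define M :: "real^3^3" where "M = (\<chi> i. vector [Re (b$i), Im (b$i), a$i])"
  have "x = 0" if "M *v x = 0" for x
  proof -
    have "Re (Complex (x$1) (- x$2) * b$i) + x$3 * a$i = (M *v x) $ i" for i
      by (simp add: M_def matrix_vector_mult_def sum_3)
    then have "Complex (x$1) (- x$2) = 0 \<and> x$3 = 0"
      using that by (intro eigenvector_relation_trivial) simp
    then show ?thesis by (simp add: vec_eq_iff forall_3 complex_eq_iff)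
  qed
  then obtain N where N: "N ** M = mat 1"
    using matrix_left_invertible_ker[of M] by blast
  moreover have "M ** N = mat 1" using N matrix_left_right_inverse by blast
  moreover have "period c = (Complex ((c v* M)$1) ((c v* M)$2), of_real ((c v* M)$3))" for c
    by (simp add: period_def M_def vector_matrix_mult_def sum_3 complex_eq_iff)
  ultimately show ?thesis using that by blast
qed

lemma inj_period: "inj period"
proof -
  obtain M N :: "real^3^3" where M: "M ** N = mat 1"
    "\<And>c. period c = (Complex ((c v* M)$1) ((c v* M)$2), of_real ((c v* M)$3))"
    using period_bij by metis
  have "c = 0" if "period c = 0" for c
  proof -
    have "c v* M = 0"
      using that by (simp add: M(2) vec_eq_iff forall_3 complex_eq_iff zero_prod_def)
    then have "c v* (M ** N) = 0" by (simp flip: vector_matrix_mul_assoc)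
    then show ?thesis by (simp add: M(1))
  qed
  then show ?thesis using linear_injective_0[OF linear_period] by blast
qed

lemma period_surj: obtains c where "period c = (z, of_real s)"
proof -
  obtain M N :: "real^3^3" where M: "N ** M = mat 1"
    "\<And>c. period c = (Complex ((c v* M)$1) ((c v* M)$2), of_real ((c v* M)$3))"
    using period_bij by metis
  define y :: "real^3" where "y = vector [Re z, Im z, s]"
  have "(y v* N) v* M = y" by (simp add: vector_matrix_mul_assoc M(1))
  then have "period (y v* N) = (z, of_real s)"
    by (simp add: M(2) y_def complex_eq_iff)
  then show ?thesis using that by blast
qed

lemma lattice_discrete:
  obtains \<delta> where "\<delta> > 0" "\<And>\<kappa>. \<kappa> \<in> period_lattice \<Longrightarrow> norm \<kappa> < \<delta> \<Longrightarrow> \<kappa> = 0"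
proof -
  obtain \<delta> where \<delta>: "\<delta> > 0" "\<And>c. \<delta> * norm c \<le> norm (period c)"
    using linear_inj_bounded_below_pos[OF linear_period inj_period] by blast
  have "period m = 0" if m: "\<forall>i. m$i \<in> \<int>" and small: "norm (period m) < \<delta>" for m
  proof -
    have "\<delta> * norm m < \<delta> * 1" using \<delta>(2)[of m] small by linarith
    then have "norm m < 1" using \<open>\<delta> > 0\<close> by (simp only: mult_less_cancel_left_pos)
    then have "\<bar>m$i\<bar> < 1" for i
      using component_le_norm_cart[of m i] by linarith
    then have "m$i = 0" for i
      using Ints_nonzero_abs_less1 m by blast
    then have "m = 0" by (simp add: vec_eq_iff)
    then show ?thesis by (simp add: linear_0[OF linear_period])
  qed
  then show ?thesis using that[OF \<delta>(1)] unfolding period_lattice_def by blast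
qed

text \<open>
  The unit cube in the coordinates given by \<open>period\<close> meets every orbit of the
  translations on the slice Im w = 1: coordinates are reduced by their integer parts.
\<close>

lemma lattice_cocompact:
  obtains K where "compact K" "K \<subseteq> CH"
    "\<And>x. Im (snd x) = 1 \<Longrightarrow> \<exists>\<kappa>\<in>period_lattice. x + \<kappa> \<in> K"
proof
  define K where "K = (\<lambda>c. period c + (0, \<i>)) ` cbox 0 1"
  show "compact K"
    unfolding K_def using linear_continuous_on[of period] linear_period
    by (intro compact_continuous_image continuous_intros) (auto simp: linear_linear)
  show "K \<subseteq> CH" by (auto simp: K_def CH_def period_def)
  fix x :: "complex \<times> complex" assume x: "Im (snd x) = 1"
  obtain c where c: "period c = (fst x, of_real (Re (snd x)))" using period_surj by blast
  define m :: "real^3" where "m = (\<chi> i. - of_int \<lfloor>c$i\<rfloor>)"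
  have "period m \<in> period_lattice" by (auto simp: period_lattice_def m_def)
  moreover have "x + period m = period (c + m) + (0, \<i>)"
    using x c by (simp add: linear_add[OF linear_period] prod_eq_iff complex_eq_iff)
  moreover have "c + m \<in> cbox 0 1"
    by (auto simp: m_def mem_box_cart) linarith+
  ultimately show "\<exists>\<kappa>\<in>period_lattice. x + \<kappa> \<in> K" unfolding K_def by fastforce
qed

section \<open>The deck group\<close>

text \<open>
  The lift of the dilation, with its iterates in both directions. Every deck transformation is
  one of these followed by a lattice translation.
\<close>

definition scale :: "int \<Rightarrow> complex \<times> complex \<Rightarrow> complex \<times> complex" where
  "scale n x = (\<beta> powi n * fst x, of_real (\<alpha> powi n) * snd x)"

lemma scale_0 [simp]: "scale 0 x = x"
  by (simp add: scale_def)

lemma scale_scale: "scale m (scale n x) = scale (m + n) x"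
  using beta_nonzero alpha_gt_1 by (simp add: scale_def power_int_add)

lemma scale_add: "scale n (x + y) = scale n x + scale n y"
  by (simp add: scale_def algebra_simps)

text \<open>
  If a and b are eigenvectors of an integer matrix, the diagonal map with these eigenvalues acts on
  integer coefficient vectors through the transposed matrix, hence preserves the lattice.
\<close>

lemma lattice_vector_matrix:
  fixes B :: "int^3^3"
  assumes "\<And>i. (\<Sum>j\<in>UNIV. of_int (B$i$j) * a$j) = x * a$i"
    and "\<And>i. (\<Sum>j\<in>UNIV. of_int (B$i$j) * b$j) = y * b$i"
    and "\<kappa> \<in> period_lattice"
  shows "(y * fst \<kappa>, of_real x * snd \<kappa>) \<in> period_lattice"
proof -
  obtain m where m: "\<kappa> = period m" "\<And>i. m$i \<in> \<int>" using assms(3) by (auto simp: period_lattice_def)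
  define m' :: "real^3" where "m' = (\<chi> j. \<Sum>i\<in>UNIV. m$i * of_int (B$i$j))"
  have "y * (\<Sum>i\<in>UNIV. of_real (m$i) * b$i) = (\<Sum>i\<in>UNIV. of_real (m$i) * (y * b$i))"
    by (simp add: sum_distrib_left algebra_simps)
  also have "\<dots> = (\<Sum>j\<in>UNIV. of_real (m'$j) * b$j)"
    unfolding assms(2)[symmetric] m'_def by (simp add: sum_3 algebra_simps)
  finally have 1: "y * (\<Sum>i\<in>UNIV. of_real (m$i) * b$i) = (\<Sum>j\<in>UNIV. of_real (m'$j) * b$j)" .
  have "x * (\<Sum>i\<in>UNIV. m$i * a$i) = (\<Sum>i\<in>UNIV. m$i * (x * a$i))"
    by (simp add: sum_distrib_left algebra_simps)
  also have "\<dots> = (\<Sum>j\<in>UNIV. m'$j * a$j)"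
    unfolding assms(1)[symmetric] m'_def by (simp add: sum_3 algebra_simps)
  finally have 2: "x * (\<Sum>i\<in>UNIV. m$i * a$i) = (\<Sum>j\<in>UNIV. m'$j * a$j)" .
  have "(y * fst \<kappa>, of_real x * snd \<kappa>) = period m'"
    unfolding m(1) period_def fst_conv snd_conv 1 2[symmetric] by simp
  moreover have "m'$j \<in> \<int>" for j using m(2) by (auto simp: m'_def)
  ultimately show ?thesis by (auto simp: period_lattice_def)
qed

lemma scale_lattice: "\<kappa> \<in> period_lattice \<Longrightarrow> scale n \<kappa> \<in> period_lattice"
proof -
  have pos: "scale 1 \<kappa> \<in> period_lattice" if "\<kappa> \<in> period_lattice" for \<kappa>
    using lattice_vector_matrix[OF eigen_a eigen_b that] by (simp add: scale_def)
  have neg: "scale (-1) \<kappa> \<in> period_lattice" if "\<kappa> \<in> period_lattice" for \<kappa>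
  proof -
    have "det A = 1" using data by (simp add: inoue_data_def)
    then obtain B where B: "B ** A = mat 1" using unimodular_3_left_inverse by metis
    have BA: "(\<Sum>j\<in>UNIV. B$i$j * A$j$k) = (if i = k then 1 else 0)" for i k
      using B by (simp add: vec_eq_iff matrix_matrix_mult_def mat_def)
    have "(\<Sum>j\<in>UNIV. of_int (B$i$j) * v$j) = inverse e * v$i"
      if e: "e \<noteq> 0" and v: "\<And>i. (\<Sum>j\<in>UNIV. of_int (A$i$j) * v$j) = e * v$i"
      for e :: "'f::field" and v :: "'f^3" and i
    proof -
      have "e * (\<Sum>j\<in>UNIV. of_int (B$i$j) * v$j) = (\<Sum>j\<in>UNIV. of_int (B$i$j) * (e * v$j))"
        by (simp add: sum_distrib_left algebra_simps)
      also have "\<dots> = (\<Sum>k\<in>UNIV. of_int (\<Sum>j\<in>UNIV. B$i$j * A$j$k) * v$k)"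
        unfolding v[symmetric] by (simp add: sum_3 algebra_simps)
      also have "\<dots> = v$i" by (simp add: BA if_distrib[of of_int] if_distrib[of "\<lambda>x. x * _"] cong: if_cong)
      finally show ?thesis using e by (simp add: field_simps)
    qed
    from this[OF _ eigen_a] this[OF _ eigen_b] show ?thesis
      using lattice_vector_matrix[OF _ _ that, of B "inverse \<alpha>" "inverse \<beta>"]
        alpha_gt_1 beta_nonzero by (simp add: scale_def)
  qed
  show "\<kappa> \<in> period_lattice \<Longrightarrow> scale n \<kappa> \<in> period_lattice"
  proof (induction n rule: int_induct[of _ 0])
    case (step1 i)
    then show ?case using pos[of "scale i \<kappa>"] by (simp add: scale_scale add.commute)
  next
    case (step2 i)
    then show ?case using neg[of "scale i \<kappa>"] by (simp add: scale_scale)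
  qed simp
qed

lemma dilation_CH: "x \<in> CH \<Longrightarrow> inoue_dilation \<alpha> \<beta> x = scale 1 x + 0"
  by (cases x) (simp add: inoue_dilation_def scale_def)

lemma translation_CH:
  "x \<in> CH \<Longrightarrow> inoue_translation a b i x = scale 0 x + period (axis i 1)"
  by (cases x) (simp add: inoue_translation_def period_def axis_def if_distrib if_distribR cong: if_cong)

lemma axis_period: "period (axis i (of_int k)) \<in> period_lattice"
  unfolding period_lattice_def by (rule imageI) (simp add: axis_def)

lemma axis_lattice: "period (axis i 1) \<in> period_lattice"
  using axis_period[of i 1] by simp

lemma Im_scale: "Im (snd (scale n x)) = \<alpha> powi n * Im (snd x)"
  by (simp add: scale_def del: of_real_power_int)

lemma scale_CH: "scale n x \<in> CH \<longleftrightarrow> x \<in> CH"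
  using alpha_gt_1 by (simp add: CH_def mem_Times_iff Im_scale zero_less_mult_iff less_not_sym)

lemma affine_Bij:
  assumes f: "\<And>x. x \<in> CH \<Longrightarrow> f x = scale n x + \<kappa>" and "\<kappa> \<in> period_lattice" and "f \<in> extensional CH"
  shows "f \<in> Bij CH"
proof -
  have "bij_betw f CH CH"
  proof (rule bij_betw_byWitness[where f' = "\<lambda>y. scale (- n) (y - \<kappa>)"])
    show "\<forall>x\<in>CH. scale (- n) (f x - \<kappa>) = x" by (simp add: f scale_scale)
    have inv: "scale (- n) (y - \<kappa>) \<in> CH" if "y \<in> CH" for y
      using lattice_CH[OF lattice_minus[OF assms(2)], of y] that by (simp add: scale_CH)
    then show "(\<lambda>y. scale (- n) (y - \<kappa>)) ` CH \<subseteq> CH" by auto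
    show "\<forall>y\<in>CH. f (scale (- n) (y - \<kappa>)) = y" by (simp add: f inv scale_scale)
    show "f ` CH \<subseteq> CH" by (auto simp: f lattice_CH[OF assms(2)] scale_CH)
  qed
  then show ?thesis using assms(3) by (simp add: Bij_def)
qed

lemma generators_Bij:
  "insert (inoue_dilation \<alpha> \<beta>) (range (inoue_translation a b)) \<subseteq> Bij CH"
proof -
  have "inoue_dilation \<alpha> \<beta> \<in> extensional CH" "inoue_translation a b i \<in> extensional CH" for i
    unfolding inoue_dilation_def inoue_translation_def by (rule restrict_extensional)+
  then show ?thesis
    using affine_Bij[OF dilation_CH lattice_zero] affine_Bij[OF translation_CH axis_lattice] by blast
qed

lemma subgroup_inoue_group: "subgroup (inoue_group \<alpha> \<beta> a b) (BijGroup CH)"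
  unfolding inoue_group_def using generators_Bij
  by (intro group.generate_is_subgroup group_BijGroup) (simp add: BijGroup_def)

lemma inoue_group_Bij: "g \<in> inoue_group \<alpha> \<beta> a b \<Longrightarrow> g \<in> Bij CH"
  using subgroup.mem_carrier[OF subgroup_inoue_group] by (simp add: BijGroup_def)

lemma generators_affine:
  assumes "h \<in> insert (inoue_dilation \<alpha> \<beta>) (range (inoue_translation a b))"
  shows "\<exists>n. \<exists>\<kappa>\<in>period_lattice. \<forall>x\<in>CH. h x = scale n x + \<kappa>"
  using assms
proof
  assume "h = inoue_dilation \<alpha> \<beta>"
  then show ?thesis using dilation_CH lattice_zero by blast
next
  assume "h \<in> range (inoue_translation a b)"
  then show ?thesis using translation_CH axis_lattice by blast
qed

lemma inoue_group_affine:
  assumes "g \<in> inoue_group \<alpha> \<beta> a b"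
  shows "\<exists>n. \<exists>\<kappa>\<in>period_lattice. \<forall>x\<in>CH. g x = scale n x + \<kappa>"
  using assms unfolding inoue_group_def
proof (induction g rule: generate.induct)
  case one
  have "\<forall>x\<in>CH. \<one>\<^bsub>BijGroup CH\<^esub> x = scale 0 x + 0" by (simp add: BijGroup_def)
  then show ?case using lattice_zero by blast
next
  case (incl h)
  then show ?case by (rule generators_affine)
next
  case (inv h)
  then have h: "h \<in> Bij CH" using generators_Bij by blast
  obtain n \<kappa> where \<kappa>: "\<kappa> \<in> period_lattice" "\<forall>x\<in>CH. h x = scale n x + \<kappa>"
    using generators_affine[OF inv] by blast
  have "(inv\<^bsub>BijGroup CH\<^esub> h) y = scale (- n) y + - scale (- n) \<kappa>" if y: "y \<in> CH" for y
  proof -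
    define x where "x = inv_into CH h y"
    have "x \<in> CH" using Bij_inv_into_mem[OF h y] by (simp add: x_def)
    moreover have "h x = y"
      using h y by (auto simp: x_def Bij_def bij_betw_def f_inv_into_f)
    ultimately have "y = scale n x + \<kappa>" using \<kappa> by auto
    then have "x = scale (- n) y + - scale (- n) \<kappa>" by (simp add: scale_add scale_scale)
    then show ?thesis using h y by (simp add: inv_BijGroup x_def)
  qed
  then show ?case using lattice_minus[OF scale_lattice[OF \<kappa>(1)]] by blast
next
  case (eng g h)
  then obtain m n \<kappa> \<mu> where
    g: "\<kappa> \<in> period_lattice" "\<forall>x\<in>CH. g x = scale m x + \<kappa>" and
    h: "\<mu> \<in> period_lattice" "\<forall>x\<in>CH. h x = scale n x + \<mu>" by blast
  have gh: "g \<in> Bij CH" "h \<in> Bij CH" using eng.hyps inoue_group_Bij by (auto simp: inoue_group_def)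
  then have "h x \<in> CH" if "x \<in> CH" for x using that Bij_imp_funcset by blast
  then have "\<forall>x\<in>CH. (g \<otimes>\<^bsub>BijGroup CH\<^esub> h) x = scale (m + n) x + (scale m \<mu> + \<kappa>)"
    using g h gh by (auto simp: BijGroup_def compose_def scale_add scale_scale)
  then show ?case using lattice_add[OF scale_lattice[OF h(1)] g(1)] by blast
qed

abbreviation proj :: "complex \<times> complex \<Rightarrow> (complex \<times> complex) set" where
  "proj \<equiv> inoue_proj \<alpha> \<beta> a b"

lemma proj_self:
  assumes "x \<in> CH"
  shows "x \<in> proj x"
proof -
  have "x = \<one>\<^bsub>BijGroup CH\<^esub> x" using assms by (simp add: BijGroup_def)
  then show ?thesis
    unfolding inoue_proj_def by (rule image_eqI[where x = "\<one>\<^bsub>BijGroup CH\<^esub>"]) (rule subgroup.one_closed[OF subgroup_inoue_group])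
qed

lemma proj_group:
  assumes h: "h \<in> inoue_group \<alpha> \<beta> a b" and x: "x \<in> CH"
  shows "proj (h x) = proj x"
proof -
  let ?G = "inoue_group \<alpha> \<beta> a b"
  have mult: "(g \<otimes>\<^bsub>BijGroup CH\<^esub> k) y = g (k y)" if "g \<in> ?G" "k \<in> ?G" "y \<in> CH" for g k y
    using that inoue_group_Bij by (simp add: BijGroup_def compose_def)
  have sub: "proj (k y) \<subseteq> proj y" if "k \<in> ?G" "y \<in> CH" for k y
    unfolding inoue_proj_def
  proof (rule image_subsetI)
    fix g assume "g \<in> ?G"
    then have "g (k y) = (g \<otimes>\<^bsub>BijGroup CH\<^esub> k) y" "g \<otimes>\<^bsub>BijGroup CH\<^esub> k \<in> ?G"
      using that mult subgroup.m_closed[OF subgroup_inoue_group] by auto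
    then show "g (k y) \<in> (\<lambda>g. g y) ` ?G" by blast
  qed
  define k where "k = inv\<^bsub>BijGroup CH\<^esub> h"
  have k: "k \<in> ?G" unfolding k_def using h subgroup.m_inv_closed[OF subgroup_inoue_group] by blast
  have hx: "h x \<in> CH" using inoue_group_Bij[OF h] x Bij_imp_funcset by blast
  have "k (h x) = x"
    using inoue_group_Bij[OF h] hx x
    by (auto simp: k_def inv_BijGroup Bij_def bij_betw_def inv_into_f_f)
  then show ?thesis using sub[OF h x] sub[OF k hx] by auto
qed

text \<open>
  The group contains the translations by the three generating periods only; integer multiples and
  sums are reached step by step.
\<close>

lemma proj_lattice:
  assumes "\<kappa> \<in> period_lattice" "x \<in> CH"
  shows "proj (x + \<kappa>) = proj x"
proof -
  have unit: "proj (y + period (axis i 1)) = proj y" if "y \<in> CH" for y i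
    using proj_group[OF _ that, of "inoue_translation a b i"] translation_CH[OF that, of i]
    by (simp add: inoue_group_def generate.incl)
  have step: "proj (y + period (axis i (of_int k))) = proj y" if "y \<in> CH" for y i k
  proof (induction k rule: int_induct[of _ 0])
    case base
    show ?case by (simp add: linear_0[OF linear_period] iffD2[OF axis_eq_0_iff])
  next
    case (step1 k)
    have "axis i (of_int (k + 1) :: real) = axis i (of_int k) + axis i 1"
      by (simp add: axis_def vec_eq_iff)
    moreover have "y + period (axis i (of_int k)) \<in> CH"
      using that lattice_CH[OF axis_period] by blast
    ultimately show ?case
      using step1 unit[of "y + period (axis i (of_int k))" i]
      by (simp add: linear_add[OF linear_period] add.assoc)
  next
    case (step2 k)
    have "axis i (of_int k :: real) = axis i (of_int (k - 1)) + axis i 1"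
      by (simp add: axis_def vec_eq_iff)
    moreover have "y + period (axis i (of_int (k - 1))) \<in> CH"
      using that lattice_CH[OF axis_period] by blast
    ultimately show ?case
      using step2 unit[of "y + period (axis i (of_int (k - 1)))" i]
      by (simp add: linear_add[OF linear_period] add.assoc)
  qed
  obtain m where m: "\<kappa> = period m" "\<And>i. m$i \<in> \<int>" using assms by (auto simp: period_lattice_def)
  then have "\<forall>i. \<exists>k. m$i = of_int k" by (meson Ints_cases)
  then obtain k where k: "\<And>i. m$i = of_int (k i)" by metis
  define l where "l i = period (axis i (of_int (k i)))" for i
  have l: "l i \<in> period_lattice" for i by (simp add: l_def axis_period)
  have "m = axis 1 (of_int (k 1)) + axis 2 (of_int (k 2)) + axis 3 (of_int (k 3))"
    by (simp add: vec_eq_iff forall_3 axis_def k)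
  then have "x + \<kappa> = x + l 1 + l 2 + l 3"
    by (simp add: m(1) l_def linear_add[OF linear_period] add.assoc)
  moreover have "x + l 1 \<in> CH" "x + l 1 + l 2 \<in> CH"
    using assms(2) l by (simp_all only: lattice_CH)
  moreover have "proj (y + l i) = proj y" if "y \<in> CH" for y i
    unfolding l_def using that by (rule step)
  ultimately show ?thesis using assms(2) by (simp only:)
qed

section \<open>Charts and lifts of tensor fields\<close>

text \<open>
  The domains of the charts of the atlas, seen upstairs: the chart belonging to such a set inverts
  the projection on it.
\<close>

definition section_domain :: "(complex \<times> complex) set \<Rightarrow> bool" where
  "section_domain V \<longleftrightarrow> open V \<and> V \<subseteq> CH \<and> inj_on proj V"

definition chart :: "(complex \<times> complex) set \<Rightarrow> (complex \<times> complex) set chart" where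
  "chart V = (proj ` V, inv_into V proj)"

lemma chart_in_atlas: "section_domain V \<Longrightarrow> chart V \<in> inoue_atlas \<alpha> \<beta> a b"
  unfolding section_domain_def chart_def inoue_atlas_def by blast

lemma chart_proj: "section_domain V \<Longrightarrow> x \<in> V \<Longrightarrow> snd (chart V) (proj x) = x"
  by (simp add: section_domain_def chart_def)

lemma chart_image_chart: "section_domain V \<Longrightarrow> chart_image (chart V) = V"
  unfolding chart_image_def using chart_proj[of V] by (auto simp: chart_def image_image)

text \<open>
  The set is cut out so that no nontrivial deck transformation moves a point of it to another one:
  heights within a factor less than \<alpha> exclude a dilation part, and distances smaller than
  the norms of all nonzero periods exclude a translation.
\<close>

lemma section_domain_exists:
  assumes "x \<in> CH"
  obtains V where "section_domain V" "x \<in> V"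
proof -
  obtain \<delta> where \<delta>: "\<delta> > 0" "\<And>\<kappa>. \<kappa> \<in> period_lattice \<Longrightarrow> norm \<kappa> < \<delta> \<Longrightarrow> \<kappa> = 0"
    using lattice_discrete by blast
  \<comment> \<open>chosen so that the height of \<open>x\<close> lies between \<open>r\<close> and \<open>\<alpha> * r\<close>\<close>
  define r where "r = 2 * Im (snd x) / (1 + \<alpha>)"
  have h: "Im (snd x) > 0" using assms by (auto simp: CH_def)
  have r: "r > 0" "r < Im (snd x)" "Im (snd x) < \<alpha> * r"
    using h alpha_gt_1 by (auto simp: r_def field_simps)
  define V where "V = ball x (\<delta>/2) \<inter> {y. r < Im (snd y)} \<inter> {y. Im (snd y) < \<alpha> * r}"
  have "open V" unfolding V_def
    by (intro open_Int open_ball open_Collect_less continuous_intros)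
  moreover have "V \<subseteq> CH" using r by (auto simp: V_def CH_def)
  moreover have "inj_on proj V"
  proof (rule inj_onI)
    fix y y' assume y: "y \<in> V" "y' \<in> V" and eq: "proj y = proj y'"
    then have "y \<in> CH" "y' \<in> CH" using \<open>V \<subseteq> CH\<close> by auto
    then have "y' \<in> proj y" using eq proj_self by auto
    then obtain n \<kappa> where \<kappa>: "\<kappa> \<in> period_lattice" "y' = scale n y + \<kappa>"
      using inoue_group_affine \<open>y \<in> CH\<close> unfolding inoue_proj_def by blast
    have Im: "Im (snd y') = \<alpha> powi n * Im (snd y)"
      using \<kappa> lattice_Im by (simp add: Im_scale)
    have yy: "r < Im (snd y)" "Im (snd y) < \<alpha> * r" "r < Im (snd y')" "Im (snd y') < \<alpha> * r"
      using y by (auto simp: V_def)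
    have "n = 0"
    proof (rule ccontr)
      assume "n \<noteq> 0"
      then consider "n \<ge> 1" | "- n \<ge> 1" by linarith
      then show False
      proof cases
        case 1
        then have "\<alpha> powi n \<ge> \<alpha> powi 1"
          using alpha_gt_1 by (intro power_int_increasing) auto
        then have "\<alpha> * r \<le> \<alpha> powi n * Im (snd y)"
          using yy r alpha_gt_1 by (intro mult_mono) auto
        then show False using Im yy by linarith
      next
        case 2
        then have "\<alpha> powi (- n) \<ge> \<alpha> powi 1"
          using alpha_gt_1 by (intro power_int_increasing) auto
        then have "\<alpha> * r \<le> \<alpha> powi (- n) * Im (snd y')"
          using yy r alpha_gt_1 by (intro mult_mono) auto
        also have "\<dots> = Im (snd y)" using Im alpha_gt_1 by (simp add: power_int_minus)
        finally show False using yy by linarith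
      qed
    qed
    then have "\<kappa> = y' - y" using \<kappa> by simp
    moreover have "norm (y' - y) < \<delta>"
      using y dist_triangle_half_r[of x y' \<delta> y] by (simp add: V_def dist_norm)
    ultimately show "y = y'" using \<delta>(2) \<kappa>(1) by fastforce
  qed
  moreover have "x \<in> V" using r \<delta>(1) by (simp add: V_def)
  ultimately show ?thesis using that by (simp add: section_domain_def)
qed

text \<open>
  Charts over domains that differ by a period are related by a translation, so the transformation
  law of tensors reduces to equality of components.
\<close>

lemma Dtransition_chart:
  assumes V: "section_domain V" "x \<in> V" and V': "section_domain V'" "x + \<kappa> \<in> V'"
    and \<kappa>: "\<kappa> \<in> period_lattice"
  shows "Dtransition (chart V) (chart V') (proj x) = (\<lambda>v. v)"
proof -
  define S where "S = V \<inter> (\<lambda>y. y + \<kappa>) -` V'"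
  have "open S" using V V' unfolding S_def section_domain_def
    by (intro open_Int open_vimage continuous_intros) auto
  have "transition (chart V) (chart V') y = y + \<kappa>" if "y \<in> S" for y
  proof -
    have y: "y \<in> V" "y + \<kappa> \<in> V'" "y \<in> CH" using that V by (auto simp: S_def section_domain_def)
    have "inj_on (snd (chart V)) (fst (chart V))"
      by (simp add: chart_def inj_on_inv_into)
    then have "inv_into (fst (chart V)) (snd (chart V)) y = proj y"
      using y chart_proj[OF V(1) y(1)] by (intro inv_into_f_eq) (auto simp: chart_def)
    then show ?thesis
      using chart_proj[OF V'(1) y(2)] proj_lattice[OF \<kappa> y(3)] by (simp add: transition_def)
  qed
  moreover have "((\<lambda>y. y + \<kappa>) has_derivative (\<lambda>v. v)) (at x)"
    by (auto intro!: derivative_eq_intros)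
  moreover have "x \<in> S" using V V' by (simp add: S_def)
  ultimately have "(transition (chart V) (chart V') has_derivative (\<lambda>v. v)) (at x)"
    using \<open>open S\<close> by (auto intro: has_derivative_transform_within_open)
  then show ?thesis
    unfolding Dtransition_def chart_proj[OF V] by (rule frechet_derivative_at[symmetric])
qed

text \<open>
  With the period 0 this says that the components do not depend on the chart, with the other
  periods that the lifted components are invariant. The value type is left open so that
  one-forms and two-tensors are treated alike.
\<close>

definition periodic :: "((complex \<times> complex) set chart \<Rightarrow> complex \<times> complex \<Rightarrow> 'b) \<Rightarrow> bool" where
  "periodic T \<longleftrightarrow> (\<forall>V V' x. \<forall>\<kappa>\<in>period_lattice. section_domain V \<longrightarrow> x \<in> V \<longrightarrow>
     section_domain V' \<longrightarrow> x + \<kappa> \<in> V' \<longrightarrow> T (chart V') (x + \<kappa>) = T (chart V) x)"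

lemma periodicD:
  "periodic T \<Longrightarrow> section_domain V \<Longrightarrow> x \<in> V \<Longrightarrow> section_domain V' \<Longrightarrow> x + \<kappa> \<in> V' \<Longrightarrow>
    \<kappa> \<in> period_lattice \<Longrightarrow> T (chart V') (x + \<kappa>) = T (chart V) x"
  unfolding periodic_def by blast

lemma chart_overlap:
  assumes "section_domain V" "x \<in> V" "section_domain V'" "x + \<kappa> \<in> V'" "\<kappa> \<in> period_lattice"
  shows "proj x \<in> fst (chart V) \<inter> fst (chart V')" "snd (chart V') (proj x) = x + \<kappa>"
proof -
  have "proj (x + \<kappa>) = proj x"
    using assms by (intro proj_lattice) (auto simp: section_domain_def)
  then show "proj x \<in> fst (chart V) \<inter> fst (chart V')" "snd (chart V') (proj x) = x + \<kappa>"
    using assms chart_proj[of V' "x + \<kappa>"] by (auto simp: chart_def intro: image_eqI[of _ _ "x + \<kappa>"])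
qed

lemma one_form_periodic:
  assumes "one_form (inoue_atlas \<alpha> \<beta> a b) \<eta>"
  shows "periodic \<eta>"
  unfolding periodic_def
proof (intro allI ballI impI ext)
  fix V V' x \<kappa> v
  assume *: "section_domain V" "x \<in> V" "section_domain V'" "x + \<kappa> \<in> V'" "\<kappa> \<in> period_lattice"
  have "\<eta> (chart V) (snd (chart V) (proj x)) v
      = \<eta> (chart V') (snd (chart V') (proj x)) (Dtransition (chart V) (chart V') (proj x) v)"
    using assms chart_in_atlas[OF *(1)] chart_in_atlas[OF *(3)] chart_overlap(1)[OF *]
    unfolding one_form_def by blast
  then show "\<eta> (chart V') (x + \<kappa>) v = \<eta> (chart V) x v"
    by (simp add: chart_proj[OF *(1,2)] chart_overlap(2)[OF *] Dtransition_chart[OF *])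
qed

lemma two_tensor_periodic:
  assumes "two_tensor (inoue_atlas \<alpha> \<beta> a b) \<omega>"
  shows "periodic \<omega>"
  unfolding periodic_def
proof (intro allI ballI impI ext)
  fix V V' x \<kappa> u v
  assume *: "section_domain V" "x \<in> V" "section_domain V'" "x + \<kappa> \<in> V'" "\<kappa> \<in> period_lattice"
  let ?D = "Dtransition (chart V) (chart V') (proj x)"
  have "\<omega> (chart V) (snd (chart V) (proj x)) u v
      = \<omega> (chart V') (snd (chart V') (proj x)) (?D u) (?D v)"
    using assms chart_in_atlas[OF *(1)] chart_in_atlas[OF *(3)] chart_overlap(1)[OF *]
    unfolding two_tensor_def by blast
  then show "\<omega> (chart V') (x + \<kappa>) u v = \<omega> (chart V) x u v"
    by (simp add: chart_proj[OF *(1,2)] chart_overlap(2)[OF *] Dtransition_chart[OF *])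
qed

definition lift ::
    "((complex \<times> complex) set chart \<Rightarrow> complex \<times> complex \<Rightarrow> 'b) \<Rightarrow> complex \<times> complex \<Rightarrow> 'b" where
  "lift T x = T (chart (SOME V. section_domain V \<and> x \<in> V)) x"

lemma lift_eq:
  assumes "periodic T" "section_domain V" "x \<in> V"
  shows "lift T x = T (chart V) x"
proof -
  define W where "W = (SOME V. section_domain V \<and> x \<in> V)"
  have W: "section_domain W \<and> x \<in> W"
    unfolding W_def by (rule someI[of _ V]) (use assms in simp)
  have "T (chart W) (x + 0) = T (chart V) x"
    using periodicD[OF assms, of W 0] W lattice_zero by simp
  then show ?thesis by (simp add: lift_def W_def)
qed

lemma lift_add_period:
  assumes "periodic T" "\<kappa> \<in> period_lattice" "x \<in> CH"
  shows "lift T (x + \<kappa>) = lift T x"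
proof -
  obtain V where V: "section_domain V" "x \<in> V" using section_domain_exists[OF assms(3)] by blast
  have "x + \<kappa> \<in> CH" using assms lattice_CH by blast
  then obtain V' where V': "section_domain V'" "x + \<kappa> \<in> V'" using section_domain_exists by blast
  show ?thesis
    unfolding lift_eq[OF assms(1) V] lift_eq[OF assms(1) V']
    using assms(1) V V' assms(2) by (rule periodicD)
qed

lemma continuous_on_CH_locally:
  assumes "\<And>V. section_domain V \<Longrightarrow> continuous_on V f"
  shows "continuous_on CH f"
proof -
  have "isCont f x" if x: "x \<in> CH" for x
  proof -
    obtain V where V: "section_domain V" "x \<in> V" using section_domain_exists[OF x] by blast
    then show ?thesis
      using assms[OF V(1)] continuous_on_eq_continuous_at[of V f] by (simp add: section_domain_def)
  qed
  then show ?thesis by (simp add: continuous_at_imp_continuous_on)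
qed

lemma continuous_lift_two_tensor:
  assumes "two_tensor (inoue_atlas \<alpha> \<beta> a b) \<omega>"
  shows "continuous_on CH (\<lambda>x. lift \<omega> x u v)"
proof (rule continuous_on_CH_locally)
  fix V assume V: "section_domain V"
  have "Ck_on 0 (chart_image (chart V)) (\<lambda>x. \<omega> (chart V) x u v)"
    using two_tensor_smooth[OF assms chart_in_atlas[OF V]] unfolding smooth_on_def by (rule spec)
  then show "continuous_on V (\<lambda>x. lift \<omega> x u v)"
    using lift_eq[OF two_tensor_periodic[OF assms] V]
    by (simp add: chart_image_chart[OF V] cong: continuous_on_cong)
qed

lemma one_form_chart_C1:
  assumes "one_form (inoue_atlas \<alpha> \<beta> a b) \<eta>" and V: "section_domain V"
  shows "x \<in> V \<Longrightarrow> (\<lambda>x. \<eta> (chart V) x v) differentiable (at x)"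
    and "continuous_on V (\<lambda>x. frechet_derivative (\<lambda>x. \<eta> (chart V) x v) (at x) u)"
proof -
  have "Ck_on (Suc 0) (chart_image (chart V)) (\<lambda>x. \<eta> (chart V) x v)"
    using one_form_smooth[OF assms(1) chart_in_atlas[OF V]] unfolding smooth_on_def by (rule spec)
  then show "x \<in> V \<Longrightarrow> (\<lambda>x. \<eta> (chart V) x v) differentiable (at x)"
    and "continuous_on V (\<lambda>x. frechet_derivative (\<lambda>x. \<eta> (chart V) x v) (at x) u)"
    by (simp_all add: chart_image_chart[OF V] del: split_paired_All)
qed

lemma has_derivative_lift:
  assumes \<eta>: "one_form (inoue_atlas \<alpha> \<beta> a b) \<eta>" and V: "section_domain V" "x \<in> V"
  shows "((\<lambda>y. lift \<eta> y v) has_derivative frechet_derivative (\<lambda>y. \<eta> (chart V) y v) (at x)) (at x)"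
proof (rule has_derivative_transform_within_open)
  show "((\<lambda>y. \<eta> (chart V) y v) has_derivative frechet_derivative (\<lambda>y. \<eta> (chart V) y v) (at x)) (at x)"
    using one_form_chart_C1(1)[OF \<eta> V] by (simp add: frechet_derivative_works)
  show "\<eta> (chart V) y v = lift \<eta> y v" if "y \<in> V" for y
    using lift_eq[OF one_form_periodic[OF \<eta>] V(1) that] by simp
  show "open V" "x \<in> V" using V by (auto simp: section_domain_def)
qed

definition lift_deriv :: "(complex \<times> complex) set tensor1 \<Rightarrow> complex \<times> complex \<Rightarrow>
    complex \<times> complex \<Rightarrow> complex \<times> complex \<Rightarrow> real" where
  "lift_deriv \<eta> v x = frechet_derivative (\<lambda>y. lift \<eta> y v) (at x)"

lemma lift_deriv_chart:
  assumes "one_form (inoue_atlas \<alpha> \<beta> a b) \<eta>" "section_domain V" "x \<in> V"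
  shows "lift_deriv \<eta> v x = frechet_derivative (\<lambda>y. \<eta> (chart V) y v) (at x)"
  unfolding lift_deriv_def using has_derivative_lift[OF assms] by (rule frechet_derivative_at[symmetric])

lemma has_derivative_lift_deriv:
  assumes "one_form (inoue_atlas \<alpha> \<beta> a b) \<eta>" "x \<in> CH"
  shows "((\<lambda>y. lift \<eta> y v) has_derivative lift_deriv \<eta> v x) (at x)"
proof -
  obtain V where "section_domain V" "x \<in> V" using section_domain_exists[OF assms(2)] by blast
  then show ?thesis using has_derivative_lift[OF assms(1)] lift_deriv_chart[OF assms(1)] by simp
qed

lemma continuous_lift_deriv:
  assumes \<eta>: "one_form (inoue_atlas \<alpha> \<beta> a b) \<eta>"
  shows "continuous_on CH (\<lambda>x. lift_deriv \<eta> v x u)"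
proof (rule continuous_on_CH_locally)
  fix V assume V: "section_domain V"
  show "continuous_on V (\<lambda>x. lift_deriv \<eta> v x u)"
    using one_form_chart_C1(2)[OF \<eta> V] lift_deriv_chart[OF \<eta> V] by (simp cong: continuous_on_cong)
qed

lemma continuous_lift_one_form:
  assumes \<eta>: "one_form (inoue_atlas \<alpha> \<beta> a b) \<eta>"
  shows "continuous_on CH (\<lambda>x. lift \<eta> x v)"
  by (intro continuous_at_imp_continuous_on ballI)
    (rule has_derivative_continuous[OF has_derivative_lift_deriv[OF \<eta>]])

section \<open>Periodic functions on a horizontal slice\<close>

lemma periodic_slice_bounds:
  fixes f :: "complex \<times> complex \<Rightarrow> real"
  assumes cont: "continuous_on CH f"
    and per: "\<And>x \<kappa>. x \<in> CH \<Longrightarrow> \<kappa> \<in> period_lattice \<Longrightarrow> f (x + \<kappa>) = f x"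
  obtains y C where "y \<in> CH" "\<And>x. Im (snd x) = 1 \<Longrightarrow> f y \<le> f x"
    "\<And>x. Im (snd x) = 1 \<Longrightarrow> \<bar>f x\<bar> \<le> C"
proof -
  obtain K where K: "compact K" "K \<subseteq> CH" "\<And>x. Im (snd x) = 1 \<Longrightarrow> \<exists>\<kappa>\<in>period_lattice. x + \<kappa> \<in> K"
    using lattice_cocompact by metis
  have rep: "\<exists>k\<in>K. f x = f k" if slice: "Im (snd x) = 1" for x
  proof -
    obtain \<kappa> where "\<kappa> \<in> period_lattice" "x + \<kappa> \<in> K" using K(3)[OF slice] by blast
    moreover have "x \<in> CH" using slice by (simp add: CH_def mem_Times_iff)
    ultimately show ?thesis using per by metis
  qed
  have contK: "continuous_on K f" using cont K(2) continuous_on_subset by blast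
  moreover have "K \<noteq> {}" using rep[of "(0, \<i>)"] by auto
  ultimately obtain y where y: "y \<in> K" "\<And>x. x \<in> K \<Longrightarrow> f y \<le> f x"
    using continuous_attains_inf K(1) by metis
  obtain C where "\<And>x. x \<in> K \<Longrightarrow> \<bar>f x\<bar> \<le> C"
    using compact_imp_bounded[OF compact_continuous_image[OF contK K(1)]]
    by (auto simp: bounded_iff)
  then have "\<bar>f x\<bar> \<le> C" "f y \<le> f x" if "Im (snd x) = 1" for x
    using rep[OF that] y(2) by auto
  then show ?thesis using that[of y C] y(1) K(2) by blast
qed

text \<open>
  The plane argument is applied on w = i, with p = \<eta>(J e) and q = \<eta>(e). The infimum of
  \<omega>(e, J e) over the slice is attained at a point of C x H, hence is positive.
\<close>

lemma no_primitive_in_fibre_direction: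
  assumes \<eta>: "one_form (inoue_atlas \<alpha> \<beta> a b) \<eta>" and \<omega>: "two_tensor (inoue_atlas \<alpha> \<beta> a b) \<omega>"
    and eq: "\<And>x. x \<in> CH \<Longrightarrow>
      lift \<omega> x (1, 0) (\<i>, 0) = lift_deriv \<eta> (\<i>, 0) x (1, 0) - lift_deriv \<eta> (1, 0) x (\<i>, 0)"
    and pos: "\<And>x. x \<in> CH \<Longrightarrow> lift \<omega> x (1, 0) (\<i>, 0) > 0"
  shows False
proof -
  note per = lift_add_period[OF one_form_periodic[OF \<eta>]]
  define \<gamma> :: "real \<Rightarrow> real \<Rightarrow> complex \<times> complex" where "\<gamma> x y = (Complex x y, \<i>)" for x y
  have \<gamma>: "\<gamma> x y \<in> CH" "Im (snd (\<gamma> x y)) = 1" for x y by (auto simp: \<gamma>_def CH_def)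
  have \<gamma>_alt: "\<gamma> x y = x *\<^sub>R (1, 0) + y *\<^sub>R (\<i>, 0) + (0, \<i>)" for x y
    by (simp add: \<gamma>_def complex_eq_iff)
  have cont_\<gamma>: "continuous_on S (\<lambda>s. \<gamma> (f s) (g s))"
    if "continuous_on S f" "continuous_on S g" for S :: "'s::topological_space set" and f g
    unfolding \<gamma>_alt using that by (intro continuous_intros)
  obtain y0 where y0: "y0 \<in> CH"
    "\<And>x. Im (snd x) = 1 \<Longrightarrow> lift \<omega> y0 (1, 0) (\<i>, 0) \<le> lift \<omega> x (1, 0) (\<i>, 0)"
    by (rule periodic_slice_bounds[OF continuous_lift_two_tensor[OF \<omega>, of "(1, 0)" "(\<i>, 0)"]])
      (auto simp: lift_add_period[OF two_tensor_periodic[OF \<omega>]])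
  obtain C1 where C1: "\<And>x. Im (snd x) = 1 \<Longrightarrow> \<bar>lift \<eta> x (\<i>, 0)\<bar> \<le> C1"
    by (rule periodic_slice_bounds[OF continuous_lift_one_form[OF \<eta>, of "(\<i>, 0)"]]) (auto simp: per)
  obtain C2 where C2: "\<And>x. Im (snd x) = 1 \<Longrightarrow> \<bar>lift \<eta> x (1, 0)\<bar> \<le> C2"
    by (rule periodic_slice_bounds[OF continuous_lift_one_form[OF \<eta>, of "(1, 0)"]]) (auto simp: per)
  have deriv: "((\<lambda>s. lift \<eta> (c s) v) has_real_derivative lift_deriv \<eta> v (c s) u) (at s)"
    if "\<And>s. c s \<in> CH" "(c has_derivative (\<lambda>h. h *\<^sub>R u)) (at s)" for c s u v
  proof -
    have D: "((\<lambda>y. lift \<eta> y v) has_derivative lift_deriv \<eta> v (c s)) (at (c s))"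
      by (rule has_derivative_lift_deriv[OF \<eta> that(1)])
    have "((\<lambda>s. lift \<eta> (c s) v) has_derivative (\<lambda>h. lift_deriv \<eta> v (c s) (h *\<^sub>R u))) (at s)"
      by (rule has_derivative_compose[OF that(2) D])
    moreover have "lift_deriv \<eta> v (c s) (h *\<^sub>R u) = lift_deriv \<eta> v (c s) u * h" for h
      using linear_cmul[OF has_derivative_linear[OF D]] by simp
    ultimately show ?thesis by (simp add: has_field_derivative_def)
  qed
  show False
  proof (rule divergence_of_bounded_field_not_uniformly_positive)
    show "((\<lambda>x. lift \<eta> (\<gamma> x y) (\<i>, 0)) has_real_derivative lift_deriv \<eta> (\<i>, 0) (\<gamma> x y) (1, 0)) (at x)"
      for x y
      by (rule deriv[OF \<gamma>(1)]) (auto simp: \<gamma>_alt intro!: derivative_eq_intros)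
    show "((\<lambda>y. lift \<eta> (\<gamma> x y) (1, 0)) has_real_derivative lift_deriv \<eta> (1, 0) (\<gamma> x y) (\<i>, 0)) (at y)"
      for x y
      by (rule deriv[OF \<gamma>(1)]) (auto simp: \<gamma>_alt intro!: derivative_eq_intros)
    show "continuous_on UNIV (\<lambda>y. lift \<eta> (\<gamma> x y) (\<i>, 0))" for x
      by (rule continuous_on_compose2[OF continuous_lift_one_form[OF \<eta>] cont_\<gamma>])
        (auto simp: \<gamma> intro!: continuous_intros)
    show "continuous_on UNIV (\<lambda>(x, y). lift_deriv \<eta> (\<i>, 0) (\<gamma> x y) (1, 0))"
      unfolding case_prod_beta
      by (rule continuous_on_compose2[OF continuous_lift_deriv[OF \<eta>] cont_\<gamma>])
        (auto simp: \<gamma> intro!: continuous_intros)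
    show "\<bar>lift \<eta> (\<gamma> x y) (\<i>, 0)\<bar> \<le> max C1 C2" "\<bar>lift \<eta> (\<gamma> x y) (1, 0)\<bar> \<le> max C1 C2" for x y
      using C1[OF \<gamma>(2)] C2[OF \<gamma>(2)] by (auto simp: le_max_iff_disj)
    show "lift \<omega> y0 (1, 0) (\<i>, 0) > 0" by (rule pos[OF y0(1)])
    show "lift \<omega> y0 (1, 0) (\<i>, 0)
        \<le> lift_deriv \<eta> (\<i>, 0) (\<gamma> x y) (1, 0) - lift_deriv \<eta> (1, 0) (\<gamma> x y) (\<i>, 0)" for x y
      using y0(2)[OF \<gamma>(2)] eq[OF \<gamma>(1)] by simp
  qed
qed

end

section \<open>Failure of twisted exactness\<close>

theorem claim3p13:
  fixes A :: "int^3^3" and \<alpha> t :: real and \<beta> :: complex and a :: "real^3" and b :: "complex^3"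
    and \<theta>\<^sub>1 :: "(complex \<times> complex) set tensor1"
    and \<omega>\<^sub>1 :: "(complex \<times> complex) set tensor2"
  assumes "inoue_data A \<alpha> \<beta> a b"
    and "\<theta>\<^sub>1 = (\<lambda>c x v. t * inoue_vartheta \<alpha> c x v)"
    and "LCK_form (inoue_atlas \<alpha> \<beta> a b) \<omega>\<^sub>1 \<theta>\<^sub>1"
  shows "\<not> twisted_exact (inoue_atlas \<alpha> \<beta> a b) \<theta>\<^sub>1 \<omega>\<^sub>1"
proof
  interpret inoue_surface A \<alpha> \<beta> a b by (rule inoue_surface.intro) (rule assms(1))
  assume "twisted_exact (inoue_atlas \<alpha> \<beta> a b) \<theta>\<^sub>1 \<omega>\<^sub>1"
  then obtain \<eta> where \<eta>: "one_form (inoue_atlas \<alpha> \<beta> a b) \<eta>"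
    and exact: "\<And>c x u v. c \<in> inoue_atlas \<alpha> \<beta> a b \<Longrightarrow> x \<in> chart_image c \<Longrightarrow>
      \<omega>\<^sub>1 c x u v = ext_d1 \<eta> c x u v - wedge11 \<theta>\<^sub>1 \<eta> c x u v"
    unfolding twisted_exact_def by blast
  obtain g where g: "hermitian_metric (inoue_atlas \<alpha> \<beta> a b) g"
    and fund: "fundamental_form (inoue_atlas \<alpha> \<beta> a b) g \<omega>\<^sub>1"
    using assms(3) unfolding LCK_form_def by blast
  have \<omega>: "two_tensor (inoue_atlas \<alpha> \<beta> a b) \<omega>\<^sub>1"
    using fund by (simp add: fundamental_form_def two_form_def)
  have \<theta>: "\<theta>\<^sub>1 c x (1, 0) = 0" "\<theta>\<^sub>1 c x (\<i>, 0) = 0" for c x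
    by (simp_all add: assms(2) inoue_vartheta_def)
  show False
  proof (rule no_primitive_in_fibre_direction[OF \<eta> \<omega>])
    fix x assume "x \<in> CH"
    then obtain V where V: "section_domain V" "x \<in> V" using section_domain_exists by blast
    note lift_\<omega> = lift_eq[OF two_tensor_periodic[OF \<omega>] V]
    have c: "chart V \<in> inoue_atlas \<alpha> \<beta> a b" "x \<in> chart_image (chart V)"
      using V chart_in_atlas chart_image_chart by auto
    show "lift \<omega>\<^sub>1 x (1, 0) (\<i>, 0) = lift_deriv \<eta> (\<i>, 0) x (1, 0) - lift_deriv \<eta> (1, 0) x (\<i>, 0)"
      using exact[OF c] by (simp add: lift_\<omega> lift_deriv_chart[OF \<eta> V] ext_d1_def wedge11_def \<theta>)
    have "\<omega>\<^sub>1 (chart V) x (1, 0) (\<i>, 0) = g (chart V) x (cplx_J (1, 0)) (\<i>, 0)"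
      using fund c unfolding fundamental_form_def by blast
    also have "\<dots> = g (chart V) x (\<i>, 0) (\<i>, 0)" by (simp add: cplx_J_def)
    also have "\<dots> > 0"
    proof -
      have "(\<i>, 0) \<noteq> (0 :: cvec)" by (simp add: zero_prod_def)
      then show ?thesis using g c unfolding hermitian_metric_def by blast
    qed
    finally show "lift \<omega>\<^sub>1 x (1, 0) (\<i>, 0) > 0" by (simp add: lift_\<omega>)
  qed
qed

end
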